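(* Let $E$ be a Banach space with normalized Schauder basis $(e_n)_n$, let $\mathcal{D}_E$ be a set of blocks for $E$ and $\mathcal{A}_E$ an admissible set for $E$. Suppose that $X=[x_n]_n$ is a $\mathcal{D}_E$-block subspace and $Y$ is a $\mathcal{D}_X$-block subspace of $X$. Then $Y$ is $\mathcal{A}_E$-tight in $(x_n)_n$ if and only if the set $$E^{\mathcal{A}}_{Y,X}:=\{\mathfrak{u}\in 2^\omega:\ Y\overset{\mathcal{A}}{\hookrightarrow}[x_n:n\in\mathrm{supp}(\mathfrak{u})]\}$$ is meager in the Cantor space $2^\omega$, where $\mathrm{supp}(\mathfrak{u})=\{i\in\mathbb{N}:\mathfrak{u}_i=1\}$.
   Context: Conventions. Banach spaces are separable, infinite dimensional (real). $\mathbb{N}=\omega=\{0,1,2,\dots\}$; $[\mathbb{N}]^{\infty}$ is the set of infinite subsets of $\mathbb{N}$. $2^\omega=\{0,1\}^\omega$ has the product topology. $[x_n]_n$ is the closed linear span. Given the basis $(e_n)_n$ of $E$, $\mathrm{supp}_E(x)=\{n: e_n^*(x)\neq 0\}$, and $x<y$ means $\max \mathrm{supp}_E(x)<\min\mathrm{supp}_E(y)$. A block basis of $(e_n)_n$ is a sequence $(x_n)_n$ of nonzero finitely supported vectors with $x_n<x_{n+1}$ for all $n$; if $X=[x_n]_n$, $\mathrm{supp}_X(u)$ is the support of $u\in X$ with respect to the basis $(x_n)_n$. For $K\ge 1$, $(x_n)_n\sim_K (y_n)_n$ means $\frac1K\|\sum_{n\le k}a_nx_n\|\le\|\sum_{n\le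 k}a_ny_n\|\le K\|\sum_{n\le k}a_nx_n\|$ for all $k$ and all scalars; $\sim$ means $\sim_K$ for some $K\geq1$. Intervals are sets $[a,b]\cap\mathbb{N}$ with $0\le a<b$; $(I_i)_i$ is successive if $\max I_i<\min I_{i+1}$ for all $i$. Fix a countable subfield $\mathbf{F}_E\subseteq\mathbb{R}$ containing $\mathbb{Q}$ such that every finite $\mathbf{F}_E$-linear combination of $(e_n)_n$ has norm in $\mathbf{F}_E$; $\mathbb{D}_E$ is the set of nonzero finite $\mathbf{F}_E$-linear combinations of $(e_n)_n$. Operation $\ast_X$. Let $X=[x_n]_n$ with $(x_n)_n$ a sequence of successive finitely supported vectors. For $u=(u_n)_n\in(\mathbb{D}_E\cap X)^\omega$ with $u_n=\sum_{i\in \mathrm{supp}_X(u_n)}\lambda_i^n x_i$ and $v=(v_n)_n\in(\mathbb{D}_E)^\omega$, $u\ast_X v$ is the sequence $(w_n)_n$ with $w_n=\sum_{i\in\mathrm{supp}_X(u_n)}\lambda_i^n v_i$. Set of blocks. $\mathcal{D}_E$ is a set of blocks for $E$ if: (a) $\mathcal{D}_E\subseteq\mathbb{D}_E$; (b) $e_n\in\mathcal{D}_E$ for all $n$; (c) $u\in\mathcal{D}_E\Rightarrow u/\|u\|\in\mathcal{D}_E$; (d) $u,v\in(\mathcal{D}_E)^\omega\Rightarrow u\ast_E v\in(\mathcal{D}_E)^\omega$; (e) if $x_0<\dots<x_n$ are in $\mathcal{D}_E$ and $\sum_{i\le n}\lambda_i x_i\in\mathcal{D}_E$, then $\sum_{i\le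 n}\lambda_i e_i\in\mathcal{D}_E$. Block subspaces. A $\mathcal{D}_E$-block sequence is a block basis of $(e_n)_n$ all of whose terms lie in $\mathcal{D}_E$. A $\mathcal{D}_E$-block subspace is the closed span $X=[x_n]_n$ of a normalized $\mathcal{D}_E$-block sequence $(x_n)_n$, which is its fixed basis. For such $X$, $\mathcal{D}_X:=\mathcal{D}_E\cap X$; a $\mathcal{D}_X$-block subspace is the closed span of a normalized block basis of $(e_n)_n$ with all terms in $\mathcal{D}_X$. Admissible set. With $\mathcal{D}_E$ discrete and $(\mathcal{D}_E)^\omega$ carrying the product topology, $\mathcal{A}_E$ is an admissible set for $E$ (relative to $\mathcal{D}_E$) if: (a) $\mathcal{A}_E$ is a closed subset of $(\mathcal{D}_E)^\omega$; (b) it contains all $\mathcal{D}_E$-block sequences; (c) for every $(y_n)_n\in\mathcal{A}_E$, every $\mathcal{D}_E$-block subspace $X=[x_n]_n$ and every $(u_n)_n\in(\mathcal{D}_X)^\omega$: $(u_n)_n\in\mathcal{A}_E\iff (u_n)_n\ast_X(y_n)_n\in\mathcal{A}_E$; (d) for every $\mathcal{D}_E$-block sequence $(y_n)_n$ with $Y=[y_n]_n$, every $(u_n)_n\in\mathcal{A}_E$ and $k\in\mathbb{N}$ there is $(v_n)_n\in Y^\omega$ with $(u_0,\dots,u_k,v_0,v_1,\dots)\in\mathcal{A}_E$. Embedding. For a Banach space $Y$ with normalized basis $(y_n)_n$ and a subspace $Z\subseteq E$, $Y\overset{\mathcal{A}}{\hookrightarrow}Z$ means that some $(u_n)_n\in\mathcal{A}_E\cap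 Z^\omega$ satisfies $(u_n)_n\sim(y_n)_n$. Tightness. $Y$ is $\mathcal{A}_E$-tight in $(x_n)_n$ if there is a sequence of successive intervals $(I_i)_i$ such that for every $A\in[\mathbb{N}]^\infty$, $Y\overset{\mathcal{A}}{\hookrightarrow}[x_n:n\notin\bigcup_{i\in A}I_i]$ fails. *)

theory Defs
  imports "HOL-Analysis.Analysis"
begin

section \<open>Schauder bases and block bases\<close>

definition schauder_basis :: "(nat \<Rightarrow> 'a::banach) \<Rightarrow> bool" where
  "schauder_basis e \<longleftrightarrow> (\<forall>x. \<exists>!a::nat \<Rightarrow> real. (\<lambda>n. a n *\<^sub>R e n) sums x)"

definition normalized :: "(nat \<Rightarrow> 'a::real_normed_vector) \<Rightarrow> bool" where
  "normalized x \<longleftrightarrow> (\<forall>n. norm (x n) = 1)"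

definition closed_span :: "'a::real_normed_vector set \<Rightarrow> 'a set" where
  "closed_span S = closure (span S)"

text \<open>
  Coordinates and support of \<open>u\<close> with respect to a sequence \<open>b\<close>. They are meaningful when \<open>b\<close> is
  a basis of its closed span and \<open>u\<close> lies in that span; \<open>b\<close> is either the basis of the whole
  space or a block basis of it.
\<close>

definition coord :: "(nat \<Rightarrow> 'a::real_normed_vector) \<Rightarrow> 'a \<Rightarrow> nat \<Rightarrow> real" where
  "coord b u = (THE a. (\<lambda>n. a n *\<^sub>R b n) sums u)"

definition supp :: "(nat \<Rightarrow> 'a::real_normed_vector) \<Rightarrow> 'a \<Rightarrow> nat set" where
  "supp b u = {n. coord b u n \<noteq> 0}"

text \<open>Only used for vectors with finite nonempty support.\<close>

definition vec_less :: "(nat \<Rightarrow> 'a::real_normed_vector) \<Rightarrow> 'a \<Rightarrow> 'a \<Rightarrow> bool" where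
  "vec_less e x y \<longleftrightarrow> Max (supp e x) < Min (supp e y)"

definition block_basis :: "(nat \<Rightarrow> 'a::real_normed_vector) \<Rightarrow> (nat \<Rightarrow> 'a) \<Rightarrow> bool" where
  "block_basis e x \<longleftrightarrow>
     (\<forall>n. x n \<noteq> 0 \<and> finite (supp e (x n))) \<and> (\<forall>n. vec_less e (x n) (x (Suc n)))"

definition seq_equiv_const ::
    "real \<Rightarrow> (nat \<Rightarrow> 'a::real_normed_vector) \<Rightarrow> (nat \<Rightarrow> 'b::real_normed_vector) \<Rightarrow> bool" where
  "seq_equiv_const K x y \<longleftrightarrow>
     (\<forall>k (a::nat \<Rightarrow> real).
        1 / K * norm (\<Sum>n\<le>k. a n *\<^sub>R x n) \<le> norm (\<Sum>n\<le>k. a n *\<^sub>R y n) \<and>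
        norm (\<Sum>n\<le>k. a n *\<^sub>R y n) \<le> K * norm (\<Sum>n\<le>k. a n *\<^sub>R x n))"

definition seq_equiv ::
    "(nat \<Rightarrow> 'a::real_normed_vector) \<Rightarrow> (nat \<Rightarrow> 'b::real_normed_vector) \<Rightarrow> bool" where
  "seq_equiv x y \<longleftrightarrow> (\<exists>K\<ge>1. seq_equiv_const K x y)"


section \<open>Sets of blocks\<close>

definition fin_lincombs :: "real set \<Rightarrow> (nat \<Rightarrow> 'a::real_normed_vector) \<Rightarrow> 'a set" where
  "fin_lincombs F e = {\<Sum>i\<in>S. c i *\<^sub>R e i | S c. finite S \<and> (\<forall>i\<in>S. c i \<in> F)}"

definition scalar_field_for :: "real set \<Rightarrow> (nat \<Rightarrow> 'a::real_normed_vector) \<Rightarrow> bool" where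
  "scalar_field_for F e \<longleftrightarrow>
     countable F \<and> \<rat> \<subseteq> F \<and>
     (\<forall>a\<in>F. \<forall>b\<in>F. a + b \<in> F \<and> a * b \<in> F) \<and>
     (\<forall>a\<in>F. - a \<in> F) \<and> (\<forall>a\<in>F. a \<noteq> 0 \<longrightarrow> inverse a \<in> F) \<and>
     norm ` fin_lincombs F e \<subseteq> F"

definition all_blocks :: "real set \<Rightarrow> (nat \<Rightarrow> 'a::real_normed_vector) \<Rightarrow> 'a set" where
  "all_blocks F e = fin_lincombs F e - {0}"

text \<open>
  The operation \<open>u \<ast>\<^bsub>X\<^esub> v\<close> for \<open>X\<close> the closed span of \<open>x\<close>, where each \<open>u n\<close> has finite support
  with respect to \<open>x\<close>; the case \<open>x = e\<close> gives \<open>\<ast>\<^bsub>E\<^esub>\<close>.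
\<close>

definition star ::
    "(nat \<Rightarrow> 'a::real_normed_vector) \<Rightarrow> (nat \<Rightarrow> 'a) \<Rightarrow> (nat \<Rightarrow> 'a) \<Rightarrow> nat \<Rightarrow> 'a" where
  "star x u v = (\<lambda>n. \<Sum>i\<in>supp x (u n). coord x (u n) i *\<^sub>R v i)"

definition set_of_blocks :: "real set \<Rightarrow> (nat \<Rightarrow> 'a::real_normed_vector) \<Rightarrow> 'a set \<Rightarrow> bool" where
  "set_of_blocks F e D \<longleftrightarrow>
     D \<subseteq> all_blocks F e \<and>
     (\<forall>n. e n \<in> D) \<and>
     (\<forall>u\<in>D. u /\<^sub>R norm u \<in> D) \<and>
     (\<forall>u v. (\<forall>n. u n \<in> D) \<and> (\<forall>n. v n \<in> D) \<longrightarrow> (\<forall>n. star e u v n \<in> D)) \<and>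
     (\<forall>n x (l::nat \<Rightarrow> real).
        (\<forall>i\<le>n. x i \<in> D) \<and> (\<forall>i<n. vec_less e (x i) (x (Suc i))) \<and>
        (\<Sum>i\<le>n. l i *\<^sub>R x i) \<in> D \<longrightarrow> (\<Sum>i\<le>n. l i *\<^sub>R e i) \<in> D)"

definition block_sequence ::
    "(nat \<Rightarrow> 'a::real_normed_vector) \<Rightarrow> 'a set \<Rightarrow> (nat \<Rightarrow> 'a) \<Rightarrow> bool" where
  "block_sequence e D x \<longleftrightarrow> block_basis e x \<and> (\<forall>n. x n \<in> D)"

text \<open>
  \<open>X\<close> is a \<open>D\<close>-block subspace with fixed basis \<open>x\<close>. For a block subspace \<open>X\<close>, the
  \<open>D\<^sub>X\<close>-block subspaces are obtained by taking \<open>D \<inter> X\<close> for \<open>D\<close>: they are block sequences of \<open>e\<close>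
  with terms in \<open>D \<inter> X\<close>.
\<close>

definition block_subspace ::
    "(nat \<Rightarrow> 'a::real_normed_vector) \<Rightarrow> 'a set \<Rightarrow> (nat \<Rightarrow> 'a) \<Rightarrow> 'a set \<Rightarrow> bool" where
  "block_subspace e D x X \<longleftrightarrow>
     block_sequence e D x \<and> normalized x \<and> X = closed_span (range x)"


section \<open>Admissible sets, embeddings and tightness\<close>

definition admissible_set ::
    "(nat \<Rightarrow> 'a::real_normed_vector) \<Rightarrow> 'a set \<Rightarrow> (nat \<Rightarrow> 'a) set \<Rightarrow> bool" where
  "admissible_set e D A \<longleftrightarrow>
     closedin (product_topology (\<lambda>_::nat. discrete_topology D) UNIV) A \<and>
     (\<forall>x. block_sequence e D x \<longrightarrow> x \<in> A) \<and>
     (\<forall>y\<in>A. \<forall>x X u. block_subspace e D x X \<and> (\<forall>n. u n \<in> D \<inter> X) \<longrightarrow>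
        (u \<in> A \<longleftrightarrow> star x u y \<in> A)) \<and>
     (\<forall>y. block_sequence e D y \<longrightarrow>
        (\<forall>u\<in>A. \<forall>k. \<exists>v. (\<forall>n. v n \<in> closed_span (range y)) \<and>
           (\<lambda>n. if n \<le> k then u n else v (n - Suc k)) \<in> A))"

text \<open>
  \<open>Y\<close> embeds into \<open>Z\<close> relative to \<open>A\<close>; the space \<open>Y\<close> enters only through its fixed normalized
  basis \<open>y\<close>.
\<close>

definition A_embeds ::
    "(nat \<Rightarrow> 'a::real_normed_vector) set \<Rightarrow> (nat \<Rightarrow> 'b::real_normed_vector) \<Rightarrow> 'a set \<Rightarrow> bool" where
  "A_embeds A y Z \<longleftrightarrow> (\<exists>u\<in>A. (\<forall>n. u n \<in> Z) \<and> seq_equiv u y)"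

definition nat_interval :: "nat set \<Rightarrow> bool" where
  "nat_interval I \<longleftrightarrow> (\<exists>a b. a < b \<and> I = {a..b})"

definition successive_intervals :: "(nat \<Rightarrow> nat set) \<Rightarrow> bool" where
  "successive_intervals I \<longleftrightarrow>
     (\<forall>i. nat_interval (I i)) \<and> (\<forall>i. Max (I i) < Min (I (Suc i)))"

definition A_tight ::
    "(nat \<Rightarrow> 'a::real_normed_vector) set \<Rightarrow> (nat \<Rightarrow> 'b::real_normed_vector) \<Rightarrow> (nat \<Rightarrow> 'a) \<Rightarrow> bool" where
  "A_tight A y x \<longleftrightarrow>
     (\<exists>I. successive_intervals I \<and>
        (\<forall>M::nat set. infinite M \<longrightarrow> \<not> A_embeds A y (closed_span (x ` (- (\<Union>i\<in>M. I i))))))"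


section \<open>Meager sets\<close>

definition nowhere_dense :: "'a::topological_space set \<Rightarrow> bool" where
  "nowhere_dense S \<longleftrightarrow> interior (closure S) = {}"

definition meager :: "'a::topological_space set \<Rightarrow> bool" where
  "meager S \<longleftrightarrow> (\<exists>N::nat \<Rightarrow> 'a set. (\<forall>n. nowhere_dense (N n)) \<and> S = (\<Union>n. N n))"

text \<open>
  Points of the Cantor space are functions \<^typ>\<open>nat \<Rightarrow> bool\<close> (\<^term>\<open>True\<close> is the value 1). The
  library topology on this type is the product of the discrete topologies on \<^typ>\<open>bool\<close>.
\<close>

definition cantor_supp :: "(nat \<Rightarrow> bool) \<Rightarrow> nat set" where
  "cantor_supp \<uu> = {i. \<uu> i}"

definition embedding_set ::
    "(nat \<Rightarrow> 'a::real_normed_vector) set \<Rightarrow> (nat \<Rightarrow> 'b::real_normed_vector) \<Rightarrow> (nat \<Rightarrow> 'a) \<Rightarrow>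
      (nat \<Rightarrow> bool) set" where
  "embedding_set A y x = {\<uu>. A_embeds A y (closed_span (x ` cantor_supp \<uu>))}"

end

theory Submission
  imports Defs
begin

text \<open>
  The set of \<open>\<uu>\<close> such that \<open>Y\<close> embeds into the span of \<open>x\<close> over the support of \<open>\<uu>\<close> is upward
  closed, and the equivalence holds for any upward closed \<open>S \<subseteq> 2\<^sup>\<omega>\<close>. If successive intervals witness
  tightness, each \<open>\<uu> \<in> S\<close> misses only finitely many of them, and meeting all intervals from some
  index on is a nowhere dense condition. Conversely, a meager set admits consecutive intervals
  \<open>I\<^sub>i\<close> and patterns on them such that no member agrees with the patterns on infinitely many
  intervals. If \<open>\<uu> \<in> S\<close> vanished on infinitely many \<open>I\<^sub>i\<close>, inserting the patterns there would
  only enlarge \<open>\<uu>\<close>, hence stay in \<open>S\<close>: a contradiction.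
\<close>

section \<open>Cylinders in countable products\<close>

lemma open_cylinder:
  fixes u :: "nat \<Rightarrow> 'b::discrete_topology"
  shows "open {v. \<forall>i<n. v i = u i}"
proof -
  have "open ((\<lambda>v. v i) -` {u i})" for i
    by (intro open_vimage open_discrete continuous_on_product_coordinates)
  then have "open (\<Inter>i<n. (\<lambda>v. v i) -` {u i})"
    by (intro open_INT) auto
  moreover have "(\<Inter>i<n. (\<lambda>v. v i) -` {u i}) = {v. \<forall>i<n. v i = u i}"
    by auto
  ultimately show ?thesis by simp
qed

text \<open>A basic open box around \<open>u\<close> restricts only finitely many coordinates;
  \<open>n\<close> bounds them.\<close>

lemma open_contains_cylinder:
  fixes U :: "(nat \<Rightarrow> 'b::topological_space) set"
  assumes "open U" "u \<in> U"
  obtains n where "\<forall>v. (\<forall>i<n. v i = u i) \<longrightarrow> v \<in> U"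
proof -
  obtain B where B: "u \<in> Pi\<^sub>E UNIV B" "finite {i. B i \<noteq> UNIV}" "Pi\<^sub>E UNIV B \<subseteq> U"
    using product_topology_open_contains_basis[of "\<lambda>_. euclidean" UNIV U u] assms
    by (auto simp: open_fun_def)
  obtain n where n: "\<forall>i\<in>{i. B i \<noteq> UNIV}. i < n"
    using B(2) finite_nat_set_iff_bounded by blast
  have "v \<in> U" if v: "\<forall>i<n. v i = u i" for v
  proof -
    have "v i \<in> B i" for i
      using B(1) n v by (cases "B i = UNIV") (auto simp: PiE_iff)
    then show ?thesis using B(3) by (auto simp: PiE_iff)
  qed
  then show thesis using that by blast
qed

lemma nowhere_dense_subset:
  assumes "nowhere_dense T" "S \<subseteq> T"
  shows "nowhere_dense S"
  using assms interior_mono[OF closure_mono[OF assms(2)]] by (auto simp: nowhere_dense_def)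

text \<open>The cylinder of \<open>u\<close> up to \<open>m\<close> is open and nonempty, so it has
  a point outside \<open>closure C\<close>; the open complement of that closure then contains a
  whole cylinder around this point.\<close>

lemma nowhere_dense_avoiding_cylinder:
  fixes C :: "(nat \<Rightarrow> 'b::discrete_topology) set"
  assumes "nowhere_dense C"
  obtains w n where "m \<le> n" "\<And>i. i < m \<Longrightarrow> w i = u i"
    "\<forall>v. (\<forall>i<n. v i = w i) \<longrightarrow> v \<notin> C"
proof -
  let ?Z = "{v. \<forall>i<m. v i = u i}"
  have "\<not> ?Z \<subseteq> closure C"
    using interior_maximal[OF _ open_cylinder[of m u], of "closure C"] assms
    by (auto simp: nowhere_dense_def)
  then obtain w where w: "w \<in> ?Z" "w \<in> - closure C" by blast
  obtain n where n: "\<forall>v. (\<forall>i<n. v i = w i) \<longrightarrow> v \<in> - closure C"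
    by (rule open_contains_cylinder[OF _ w(2)]) (auto intro: open_Compl)
  show thesis
  proof (rule that[of "max m n" w])
    show "\<forall>v. (\<forall>i<max m n. v i = w i) \<longrightarrow> v \<notin> C"
      using n closure_subset[of C] by auto
  qed (use w in auto)
qed

text \<open>One pattern \<open>s\<close> serves all pairs: by induction on \<open>P\<close>, each
  new pair only extends the pattern to the right, which preserves what was achieved for the earlier
  pairs.\<close>

lemma nowhere_dense_avoiding_pattern_prefixes:
  fixes P :: "((nat \<Rightarrow> 'b::discrete_topology) set \<times> (nat \<Rightarrow> 'b)) set"
  assumes "finite P" "\<And>C t. (C, t) \<in> P \<Longrightarrow> nowhere_dense C"
  shows "\<exists>n s. m \<le> n \<and> (\<forall>(C, t)\<in>P. \<forall>v. (\<forall>i<m. v i = t i) \<longrightarrow> (\<forall>i\<in>{m..<n}. v i = s i) \<longrightarrow> v \<notin> C)"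
  using assms
proof (induction P rule: finite_induct)
  case empty
  then show ?case by auto
next
  case (insert p P)
  obtain C t where p: "p = (C, t)" by (cases p)
  have "\<exists>n s. m \<le> n \<and> (\<forall>(C, t)\<in>P. \<forall>v. (\<forall>i<m. v i = t i) \<longrightarrow> (\<forall>i\<in>{m..<n}. v i = s i) \<longrightarrow> v \<notin> C)"
    by (rule insert.IH, rule insert.prems, erule insertI2)
  then obtain n s where n: "m \<le> n"
    and s: "\<forall>(C, t)\<in>P. \<forall>v. (\<forall>i<m. v i = t i) \<longrightarrow> (\<forall>i\<in>{m..<n}. v i = s i) \<longrightarrow> v \<notin> C"
    by (elim exE conjE)
  \<comment> \<open>The new prefix followed by the old pattern. The extension \<open>w\<close>
    agrees with it below \<open>n\<close>, hence with \<open>s\<close> on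
    \<open>{m..<n}\<close>.\<close>
  let ?u = "\<lambda>i. if i < m then t i else s i"
  have C: "nowhere_dense C" using insert.prems p by blast
  obtain w n' where n': "n \<le> n'" and w: "\<And>i. i < n \<Longrightarrow> w i = ?u i"
    and avoid: "\<forall>v. (\<forall>i<n'. v i = w i) \<longrightarrow> v \<notin> C"
    by (rule nowhere_dense_avoiding_cylinder[OF C, where m = n and u = ?u]) (rule that)
  have "v \<notin> C" if "\<forall>i<m. v i = t i" "\<forall>i\<in>{m..<n'}. v i = w i" for v
  proof -
    have "v i = w i" if "i < n'" for i
      using that \<open>\<forall>i<m. v i = t i\<close> \<open>\<forall>i\<in>{m..<n'}. v i = w i\<close> w[of i] n by (cases "i < m") auto
    then show ?thesis using avoid by blast
  qed
  moreover have "v \<notin> C'"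
    if "(C', t') \<in> P" "\<forall>i<m. v i = t' i" "\<forall>i\<in>{m..<n'}. v i = w i" for C' t' v
  proof -
    have "v i = s i" if "i \<in> {m..<n}" for i
      using that \<open>\<forall>i\<in>{m..<n'}. v i = w i\<close> w[of i] n' by simp
    then show ?thesis using bspec[OF s that(1)] that(2) by simp
  qed
  ultimately have "\<forall>(C, t)\<in>insert p P. \<forall>v. (\<forall>i<m. v i = t i) \<longrightarrow> (\<forall>i\<in>{m..<n'}. v i = w i) \<longrightarrow> v \<notin> C"
    unfolding p by blast
  then show ?case using n n' by (intro exI[of _ n'] exI[of _ w] conjI) simp
qed

text \<open>There are only finitely many binary prefixes of length \<open>m\<close> and finitely
  many sets \<open>N k\<close> with \<open>k \<le> j\<close>, so one pattern beyond \<open>m\<close>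
  can avoid them all, whatever precedes it.\<close>

lemma nowhere_dense_avoiding_pattern:
  fixes N :: "nat \<Rightarrow> (nat \<Rightarrow> bool) set"
  assumes "\<And>k. nowhere_dense (N k)"
  shows "\<exists>n s. m + 2 \<le> n \<and> (\<forall>k\<le>j. \<forall>v\<in>N k. \<exists>i\<in>{m..<n}. v i \<noteq> s i)"
proof -
  \<comment> \<open>All binary words of length \<open>m\<close>, continued by
    \<open>False\<close>.\<close>
  let ?T = "(\<lambda>S i. i \<in> S) ` Pow {..<m}"
  obtain n s where n: "m \<le> n" and
    s: "\<And>k t v. k \<le> j \<Longrightarrow> t \<in> ?T \<Longrightarrow> (\<forall>i<m. v i = t i) \<Longrightarrow> (\<forall>i\<in>{m..<n}. v i = s i) \<Longrightarrow> v \<notin> N k"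
  proof -
    have "finite (N ` {..j} \<times> ?T)" by simp
    moreover have "nowhere_dense C" if "(C, t) \<in> N ` {..j} \<times> ?T" for C t
      using that assms by blast
    ultimately obtain n s where n: "m \<le> n"
      and s: "\<forall>(C, t)\<in>N ` {..j} \<times> ?T. \<forall>v. (\<forall>i<m. v i = t i) \<longrightarrow> (\<forall>i\<in>{m..<n}. v i = s i) \<longrightarrow> v \<notin> C"
      using nowhere_dense_avoiding_pattern_prefixes[of "N ` {..j} \<times> ?T" m] by blast
    show thesis
    proof (rule that[OF n])
      fix k t v assume k: "k \<le> j" and t: "t \<in> ?T"
      have "(N k, t) \<in> N ` {..j} \<times> ?T" using k t by blast
      from bspec[OF s this]
      show "(\<forall>i<m. v i = t i) \<Longrightarrow> (\<forall>i\<in>{m..<n}. v i = s i) \<Longrightarrow> v \<notin> N k" by simp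
    qed
  qed
  \<comment> \<open>Lengthening the window makes agreement with \<open>s\<close> harder, so two
    extra places are harmless; they secure the required length.\<close>
  have "\<exists>i\<in>{m..<n + 2}. v i \<noteq> s i" if k: "k \<le> j" and v: "v \<in> N k" for k v
  proof (rule ccontr)
    assume "\<not> ?thesis"
    then have "\<forall>i\<in>{m..<n}. v i = s i" by auto
    moreover have "(\<lambda>i. i \<in> {i. i < m \<and> v i}) \<in> ?T" by (intro imageI) auto
    ultimately show False using s[of k _ v] k v by auto
  qed
  then show ?thesis using n by (intro exI[of _ "n + 2"] exI[of _ s]) auto
qed

text \<open>The windows are chosen recursively, the \<open>j\<close>-th pattern avoiding
  \<open>N 0\<close>, ..., \<open>N j\<close>. A point of \<open>N k\<close> can thus match only
  patterns with index below \<open>k\<close>.\<close>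

lemma meager_avoiding_patterns:
  fixes S :: "(nat \<Rightarrow> bool) set"
  assumes "meager S"
  obtains m :: "nat \<Rightarrow> nat" and s :: "nat \<Rightarrow> nat \<Rightarrow> bool"
  where "\<And>j. m j + 2 \<le> m (Suc j)"
    "\<And>v. v \<in> S \<Longrightarrow> finite {j. \<forall>i\<in>{m j..<m (Suc j)}. v i = s j i}"
proof -
  obtain N :: "nat \<Rightarrow> (nat \<Rightarrow> bool) set"
    where N: "\<And>k. nowhere_dense (N k)" and S: "S = (\<Union>k. N k)"
    using assms by (auto simp: meager_def)
  obtain g :: "nat \<Rightarrow> nat \<Rightarrow> nat" and r :: "nat \<Rightarrow> nat \<Rightarrow> nat \<Rightarrow> bool"
    where g: "\<And>m j. m + 2 \<le> g m j"
      and r: "\<And>m j k v. k \<le> j \<Longrightarrow> v \<in> N k \<Longrightarrow> \<exists>i\<in>{m..<g m j}. v i \<noteq> r m j i"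
    using nowhere_dense_avoiding_pattern[of N, OF N] by metis
  define m where "m = rec_nat 0 (\<lambda>j m. g m j)"
  have m_Suc: "m (Suc j) = g (m j) j" for j by (simp add: m_def)
  show thesis
  proof (rule that[of m "\<lambda>j. r (m j) j"])
    show "m j + 2 \<le> m (Suc j)" for j by (simp only: m_Suc g)
    fix v assume "v \<in> S"
    then obtain k where k: "v \<in> N k" using S by blast
    have "{j. \<forall>i\<in>{m j..<m (Suc j)}. v i = r (m j) j i} \<subseteq> {..<k}"
    proof
      fix j assume "j \<in> {j. \<forall>i\<in>{m j..<m (Suc j)}. v i = r (m j) j i}"
      then have "\<not> k \<le> j" using r[OF _ k, of j "m j"] by (auto simp: m_Suc)
      then show "j \<in> {..<k}" by simp
    qed
    then show "finite {j. \<forall>i\<in>{m j..<m (Suc j)}. v i = r (m j) j i}"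
      using finite_subset by blast
  qed
qed

section \<open>Tightness implies meagerness\<close>

lemma successive_intervals_le_Min:
  assumes "successive_intervals I"
  shows "i \<le> Min (I i)"
proof (induction i)
  case (Suc i)
  have "nat_interval (I i)" using assms by (simp add: successive_intervals_def)
  then have "finite (I i)" "I i \<noteq> {}" by (auto simp: nat_interval_def)
  then have "Min (I i) \<le> Max (I i)" by (intro Min_le Max_in)
  moreover have "Max (I i) < Min (I (Suc i))"
    using assms by (simp add: successive_intervals_def)
  ultimately show ?case using Suc.IH by linarith
qed simp

text \<open>The set is closed, because vanishing on one finite \<open>I j\<close> is an open
  condition. Its interior is empty, because every cylinder contains a point that is eventually
  zero.\<close>

lemma nowhere_dense_eventually_meeting_intervals:
  assumes I: "successive_intervals I"
  shows "nowhere_dense {v :: nat \<Rightarrow> bool. \<forall>j\<ge>n. \<exists>i\<in>I j. v i}" (is "nowhere_dense ?C")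
proof -
  have fin: "finite (I j)" for j
  proof -
    have "nat_interval (I j)" using I by (simp add: successive_intervals_def)
    then show ?thesis by (auto simp: nat_interval_def)
  qed
  have "open (- ?C)"
  proof (subst open_subopen, rule ballI)
    fix u assume "u \<in> - ?C"
    then obtain j where j: "j \<ge> n" "\<forall>i\<in>I j. \<not> u i" by auto
    let ?Z = "{v. \<forall>i<Suc (Max (I j)). v i = u i}"
    have "?Z \<subseteq> - ?C"
    proof
      fix v assume "v \<in> ?Z"
      then have "\<forall>i\<in>I j. \<not> v i" using j(2) Max_ge[OF fin] by (simp add: less_Suc_eq_le)
      then show "v \<in> - ?C" using j(1) by blast
    qed
    then show "\<exists>T. open T \<and> u \<in> T \<and> T \<subseteq> - ?C"
      by (intro exI[of _ ?Z] conjI open_cylinder) auto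
  qed
  then have closed: "closure ?C = ?C"
    by (intro closure_closed) (simp only: closed_def)
  have "u \<notin> interior ?C" for u
  proof
    assume "u \<in> interior ?C"
    then obtain m where m: "\<forall>v. (\<forall>i<m. v i = u i) \<longrightarrow> v \<in> interior ?C"
      by (rule open_contains_cylinder[OF open_interior]) (rule that)
    let ?v = "\<lambda>i. i < m \<and> u i"
    have "?v \<in> ?C" using m[rule_format, of ?v] interior_subset by blast
    \<comment> \<open>The index is at least \<open>n\<close>, so \<open>?v\<close> must meet this
      interval, and at least \<open>m\<close>, so the interval starts where \<open>?v\<close> is
      already zero.\<close>
    then have "\<exists>i\<in>I (max n m). i < m \<and> u i" by simp
    then obtain i where i: "i \<in> I (max n m)" "i < m" by blast
    then show False
      using successive_intervals_le_Min[OF I, of "max n m"] Min_le[OF fin i(1)] by linarith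
  qed
  then show ?thesis by (auto simp: nowhere_dense_def closed)
qed

lemma A_embeds_mono:
  assumes "A_embeds A y (closed_span (x ` S))" "S \<subseteq> T"
  shows "A_embeds A y (closed_span (x ` T))"
proof -
  have "closed_span (x ` S) \<subseteq> closed_span (x ` T)"
    unfolding closed_span_def using assms(2) by (intro closure_mono span_mono image_mono)
  then show ?thesis using assms(1) by (auto simp: A_embeds_def)
qed

lemma meager_embedding_set_if_A_tight:
  assumes "A_tight A y x"
  shows "meager (embedding_set A y x)"
proof -
  obtain I where I: "successive_intervals I"
    and tight: "\<And>M. infinite M \<Longrightarrow> \<not> A_embeds A y (closed_span (x ` (- (\<Union>i\<in>M. I i))))"
    using assms by (auto simp: A_tight_def)
  let ?C = "\<lambda>n. {v :: nat \<Rightarrow> bool. \<forall>j\<ge>n. \<exists>i\<in>I j. v i}"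
  have "\<exists>n. v \<in> ?C n" if v: "v \<in> embedding_set A y x" for v
  proof -
    \<comment> \<open>The intervals missed by \<open>v\<close>: its support lies outside their
      union, so tightness forces \<open>?M\<close> to be finite.\<close>
    let ?M = "{j. \<forall>i\<in>I j. \<not> v i}"
    have "A_embeds A y (closed_span (x ` (- (\<Union>i\<in>?M. I i))))"
      by (rule A_embeds_mono[of _ _ _ "cantor_supp v"])
        (use v in \<open>auto simp: embedding_set_def cantor_supp_def\<close>)
    then have "finite ?M" using tight by blast
    then obtain n where "\<forall>j\<in>?M. j < n" using finite_nat_set_iff_bounded by blast
    then have "v \<in> ?C n" using not_le by blast
    then show ?thesis by blast
  qed
  then have "embedding_set A y x \<subseteq> (\<Union>n. ?C n)" by (simp add: subset_iff)
  \<comment> \<open>\<open>meager\<close> asks for equality with the union, hence the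
    intersections.\<close>
  then have "embedding_set A y x = (\<Union>n. ?C n \<inter> embedding_set A y x)"
    unfolding Int_UN_distrib2[symmetric] UN_extend_simps(4)[symmetric] by blast
  moreover have "nowhere_dense (?C n \<inter> embedding_set A y x)" for n
    by (rule nowhere_dense_subset[OF nowhere_dense_eventually_meeting_intervals[OF I]]) auto
  ultimately show ?thesis
    unfolding meager_def by (intro exI[of _ "\<lambda>n. ?C n \<inter> embedding_set A y x"] conjI allI)
qed

section \<open>Meagerness implies tightness\<close>

lemma A_tight_if_meager_embedding_set:
  assumes "meager (embedding_set A y x)"
  shows "A_tight A y x"
proof -
  obtain m s where m: "\<And>j. m j + 2 \<le> m (Suc j)"
    and s: "\<And>v. v \<in> embedding_set A y x \<Longrightarrow> finite {j. \<forall>i\<in>{m j..<m (Suc j)}. v i = s j i}"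
    by (rule meager_avoiding_patterns[OF assms]) (rule that)
  \<comment> \<open>The windows in closed form; length at least two gives the strict inequality of
    endpoints in \<open>nat_interval\<close>.\<close>
  define I where "I = (\<lambda>j. {m j..m (Suc j) - 1})"
  have m_less: "m j < m (Suc j) - 1" for j using m[of j] by linarith
  have I_eq: "I j = {m j..<m (Suc j)}" for j
    using m[of j] by (auto simp: I_def)
  have "nat_interval (I j)" for j
    unfolding nat_interval_def I_def
    by (intro exI[of _ "m j"] exI[of _ "m (Suc j) - 1"] conjI m_less refl)
  moreover have "Max (I j) < Min (I (Suc j))" for j
  proof -
    have "Max (I j) = m (Suc j) - 1" "Min (I (Suc j)) = m (Suc j)"
      unfolding I_def by (simp_all add: Max_eq_iff Min_eq_iff m_less[THEN less_imp_le] del: One_nat_def)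
    then show ?thesis using m_less[of j] by linarith
  qed
  ultimately have I: "successive_intervals I" by (simp add: successive_intervals_def)
  have mono: "strict_mono m"
  proof (rule strict_monoI_Suc)
    show "m j < m (Suc j)" for j using m[of j] by linarith
  qed
  have disj: "j = j'" if "i \<in> I j" "i \<in> I j'" for i j j'
  proof -
    have "m j < m (Suc j')" "m j' < m (Suc j)" using that by (simp_all add: I_eq)
    then show ?thesis using strict_mono_less[OF mono] by (simp add: less_Suc_eq_le)
  qed
  have "\<not> A_embeds A y (closed_span (x ` (- (\<Union>i\<in>M. I i))))" if M: "infinite M" for M
  proof
    assume emb: "A_embeds A y (closed_span (x ` (- (\<Union>i\<in>M. I i))))"
    \<comment> \<open>The point is 1 off the intervals indexed by \<open>M\<close>, so its support
      contains the given one. On \<open>I j\<close> with \<open>j \<in> M\<close> it equals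
      \<open>s j\<close>, since by disjointness only this \<open>j\<close> constrains it.\<close>
    define v where "v = (\<lambda>i. \<forall>j\<in>M. i \<in> I j \<longrightarrow> s j i)"
    have "v \<in> embedding_set A y x"
      unfolding embedding_set_def mem_Collect_eq
      by (rule A_embeds_mono[OF emb]) (auto simp: cantor_supp_def v_def)
    moreover have "M \<subseteq> {j. \<forall>i\<in>{m j..<m (Suc j)}. v i = s j i}"
      unfolding v_def I_eq[symmetric] using disj by blast
    ultimately show False using s M finite_subset by blast
  qed
  then show ?thesis using I by (auto simp: A_tight_def)
qed

theorem proposition7p4:
  fixes e x y :: "nat \<Rightarrow> 'a::banach"
    and F :: "real set"
    and D X Y :: "'a set"
    and A :: "(nat \<Rightarrow> 'a) set"
  assumes "schauder_basis e" and "normalized e"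
    and "scalar_field_for F e"
    and "set_of_blocks F e D"
    and "admissible_set e D A"
    and "block_subspace e D x X"
    and "block_subspace e (D \<inter> X) y Y"
  shows "A_tight A y x \<longleftrightarrow> meager (embedding_set A y x)"
  using meager_embedding_set_if_A_tight A_tight_if_meager_embedding_set by blast

end
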